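(* If $(G,\sigma)$ is a balanced signed graph, then $\chi'(G,\sigma) \leq \Delta(G)+1$. In particular, $\chi'(G,\sigma) = \Delta(G)$ if and only if $G$ has a (possibly empty) matching $M$ such that $\Delta(G-M)$ is even. The bound is best possible.
   Context: The term graph means multigraph: graphs may contain parallel edges and loops. An edge $e=vw$ consists of two half-edges $h_e(v)$ and $h_e(w)$, one incident to $v$ and the other to $w$; if $v=w$, then $e$ is a loop. $H(G)$ is the set of half-edges of $G$, and $H_G(v)$ is the set of half-edges incident to $v$. The degree is $d_G(v)=|H_G(v)|$, and $\Delta(G)=\max\{d_G(v): v\in V(G)\}$. A circuit is a connected $2$-regular graph. $G-M$ is the graph obtained from $G$ by deleting the edges of $M$. Signed graphs: let $\tau: H(G)\to\{\pm1\}$ be a function (a bidirection, or orientation, of $G$). The signed graph $(G,\sigma)$ with orientation $\tau$ is $G$ together with the function $\sigma:E(G)\to\{\pm1\}$ given by $\sigma(e)=-(\tau(h_e(v))\tau(h_e(w)))$ for each edge $e=vw$. An edge $e$ is negative if $\sigma(e)=-1$, otherwise positive. A circuit is positive if the product of the signs of its edges is positive, otherwise it is negative. $(G,\sigma)$ is balanced if all its circuits are positive. Color sets: a symmetric set is a set $S$ together with a sign "$-$" such that $s\in S$ if and only if $-s\in S$; $s=s'$ implies $-s=-s'$; and $s=-(-s)$. An element $s$ is self-inverse if $s=-s$. $S^t_{2k}$ denotes a symmetric set with self-inverse elements $0_1,\dots,0_t$ and non-self-inverse elements $\pm s_1,\dots,\pm s_k$, so $|S^t_{2k}|=t+2k$.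 Colorings: let $(G,\sigma)$ be a signed graph with orientation $\tau$ and let $t,k$ be two non-negative integers not both equal to $0$. A function $c:E(G)\to S^t_{2k}$ is an $S^t_{2k}$-coloring of $(G,\sigma)$ if $\tau(h_{e_1}(v))c(e_1)\neq\tau(h_{e_2}(v))c(e_2)$ for every vertex $v$ and any two different edges $e_1,e_2$ incident to $v$ (where $1\cdot s=s$ and $(-1)\cdot s=-s$). Chromatic index: for $i\in\{0,1\}$, $\chi'_i(G,\sigma)$ is the minimum $2k+i$ such that $(G,\sigma)$ admits an $S^i_{2k}$-coloring, and $\chi'(G,\sigma)=\min\{\chi'_0(G,\sigma),\chi'_1(G,\sigma)\}$.
   Formalization: The equivalence is stated for graphs with at least one edge (edgeless graphs have index 1 but Δ=0), and a coloring must also give the two half-edges of a loop different values (else one positive loop has Δ=2 but index 1); the sharpness examples use loops under this convention. *)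

theory Defs
  imports "HOL-Library.Disjoint_Sets" "HOL-Library.FuncSet" "HOL-Library.Extended_Nat"
begin

section \<open>Multigraphs\<close>

text \<open>
  An edge is the set of its two half-edges, and every half-edge is attached to one vertex.
  Parallel edges are different two-element sets with the same end vertices, and a loop is an
  edge whose two half-edges are attached to the same vertex.
\<close>

record ('v, 'h) multigraph =
  verts :: "'v set"
  edges :: "'h set set"
  endpt :: "'h \<Rightarrow> 'v"

definition half_edges :: "('v, 'h) multigraph \<Rightarrow> 'h set" where
  "half_edges G = \<Union> (edges G)"

definition wf_multigraph :: "('v, 'h) multigraph \<Rightarrow> bool" where
  "wf_multigraph G \<longleftrightarrow>
     finite (verts G) \<and> verts G \<noteq> {} \<and> finite (edges G) \<and>
     (\<forall>e\<in>edges G. card e = 2) \<and> disjoint (edges G) \<and>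
     endpt G ` half_edges G \<subseteq> verts G"

definition half_edges_at :: "('v, 'h) multigraph \<Rightarrow> 'v \<Rightarrow> 'h set" where
  "half_edges_at G v = {h \<in> half_edges G. endpt G h = v}"

definition degree :: "('v, 'h) multigraph \<Rightarrow> 'v \<Rightarrow> nat" where
  "degree G v = card (half_edges_at G v)"

definition max_degree :: "('v, 'h) multigraph \<Rightarrow> nat" where
  "max_degree G = Max (degree G ` verts G)"

definition delete_edges :: "('v, 'h) multigraph \<Rightarrow> 'h set set \<Rightarrow> ('v, 'h) multigraph" where
  "delete_edges G M = G\<lparr>edges := edges G - M\<rparr>"

text \<open>
  Every vertex is incident to at most one half-edge of a matching. In particular a matching
  contains no loop.
\<close>

definition matching :: "('v, 'h) multigraph \<Rightarrow> 'h set set \<Rightarrow> bool" where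
  "matching G M \<longleftrightarrow> M \<subseteq> edges G \<and> inj_on (endpt G) (\<Union> M)"

definition subgraph :: "('v, 'h) multigraph \<Rightarrow> ('v, 'h) multigraph \<Rightarrow> bool" where
  "subgraph C G \<longleftrightarrow>
     wf_multigraph C \<and> verts C \<subseteq> verts G \<and> edges C \<subseteq> edges G \<and>
     (\<forall>h\<in>half_edges C. endpt C h = endpt G h)"

definition adjacency :: "('v, 'h) multigraph \<Rightarrow> ('v \<times> 'v) set" where
  "adjacency G = {(endpt G h, endpt G h') | h h'. {h, h'} \<in> edges G}"

definition connected_graph :: "('v, 'h) multigraph \<Rightarrow> bool" where
  "connected_graph G \<longleftrightarrow> (\<forall>u\<in>verts G. \<forall>v\<in>verts G. (u, v) \<in> (adjacency G)\<^sup>*)"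

definition circuit :: "('v, 'h) multigraph \<Rightarrow> bool" where
  "circuit C \<longleftrightarrow> wf_multigraph C \<and> connected_graph C \<and> (\<forall>v\<in>verts C. degree C v = 2)"


section \<open>Signed graphs\<close>

text \<open>
  The signature is determined by the orientation, so a signed graph is given by a
  multigraph \<open>G\<close> and an orientation \<open>\<tau>\<close>.
\<close>

definition orientation :: "('v, 'h) multigraph \<Rightarrow> ('h \<Rightarrow> int) \<Rightarrow> bool" where
  "orientation G \<tau> \<longleftrightarrow> \<tau> \<in> half_edges G \<rightarrow> {1, -1}"

definition sign :: "('h \<Rightarrow> int) \<Rightarrow> 'h set \<Rightarrow> int" where
  "sign \<tau> e = - (\<Prod>h\<in>e. \<tau> h)"

definition signed_graph :: "('v, 'h) multigraph \<Rightarrow> ('h \<Rightarrow> int) \<Rightarrow> bool" where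
  "signed_graph G \<tau> \<longleftrightarrow> wf_multigraph G \<and> orientation G \<tau>"

definition balanced :: "('v, 'h) multigraph \<Rightarrow> ('h \<Rightarrow> int) \<Rightarrow> bool" where
  "balanced G \<tau> \<longleftrightarrow>
     (\<forall>C. subgraph C G \<and> circuit C \<longrightarrow> (\<Prod>e\<in>edges C. sign \<tau> e) > 0)"


section \<open>Colors\<close>

definition symmetric_set :: "'s set \<Rightarrow> ('s \<Rightarrow> 's) \<Rightarrow> bool" where
  "symmetric_set S neg \<longleftrightarrow> (\<forall>s. s \<in> S \<longleftrightarrow> neg s \<in> S) \<and> (\<forall>s\<in>S. neg (neg s) = s)"

datatype color = Zero nat | Plus nat | Minus nat

fun neg :: "color \<Rightarrow> color" where
  "neg (Zero i) = Zero i"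
| "neg (Plus i) = Minus i"
| "neg (Minus i) = Plus i"

text \<open>\<open>color_set t k\<close> is the symmetric set \<open>S\<close> with upper index \<open>t\<close> and lower index \<open>2k\<close>.\<close>

definition color_set :: "nat \<Rightarrow> nat \<Rightarrow> color set" where
  "color_set t k = Zero ` {..<t} \<union> Plus ` {..<k} \<union> Minus ` {..<k}"

lemma symmetric_color_set: "symmetric_set (color_set t k) neg"
proof -
  have "s \<in> color_set t k \<longleftrightarrow> neg s \<in> color_set t k" "neg (neg s) = s" for s
    by (cases s; auto simp: color_set_def)+
  then show ?thesis
    unfolding symmetric_set_def by blast
qed

lemma self_inverse_color_set: "{s \<in> color_set t k. neg s = s} = Zero ` {..<t}"
  by (auto simp: color_set_def)

lemma card_color_set: "card (color_set t k) = t + 2 * k"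
proof -
  have "card (Zero ` {..<t} \<union> Plus ` {..<k} \<union> Minus ` {..<k}) =
      card (Zero ` {..<t}) + card (Plus ` {..<k}) + card (Minus ` {..<k})"
    by (subst card_Un_disjoint; (subst card_Un_disjoint)?; auto)
  then show ?thesis
    by (simp add: color_set_def card_image inj_on_def)
qed

definition act :: "int \<Rightarrow> color \<Rightarrow> color" where
  "act \<epsilon> s = (if \<epsilon> = 1 then s else neg s)"


section \<open>Edge colorings and the chromatic index\<close>

text \<open>
  Conflicts are read on half-edges: any two different half-edges at a vertex must carry
  different values. For half-edges of different edges this is the usual condition. The two
  half-edges of a loop are compared as well, so that a loop uses up two values at its vertex,
  in accordance with its contribution 2 to the degree.
\<close>

definition coloring ::
  "('v, 'h) multigraph \<Rightarrow> ('h \<Rightarrow> int) \<Rightarrow> nat \<Rightarrow> nat \<Rightarrow> ('h set \<Rightarrow> color) \<Rightarrow> bool" where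
  "coloring G \<tau> t k c \<longleftrightarrow>
     \<not> (t = 0 \<and> k = 0) \<and> c \<in> edges G \<rightarrow> color_set t k \<and>
     (\<forall>v\<in>verts G. \<forall>e\<^sub>1\<in>edges G. \<forall>e\<^sub>2\<in>edges G.
        \<forall>h\<^sub>1 \<in> e\<^sub>1 \<inter> half_edges_at G v. \<forall>h\<^sub>2 \<in> e\<^sub>2 \<inter> half_edges_at G v.
          h\<^sub>1 \<noteq> h\<^sub>2 \<longrightarrow> act (\<tau> h\<^sub>1) (c e\<^sub>1) \<noteq> act (\<tau> h\<^sub>2) (c e\<^sub>2))"

text \<open>
  The infimum in \<^typ>\<open>enat\<close> is attained whenever a coloring exists. It is infinite otherwise,
  for instance in the presence of a negative loop.
\<close>

definition chromatic_index_par :: "nat \<Rightarrow> ('v, 'h) multigraph \<Rightarrow> ('h \<Rightarrow> int) \<Rightarrow> enat" where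
  "chromatic_index_par i G \<tau> = (INF k \<in> {k. \<exists>c. coloring G \<tau> i k c}. enat (2 * k + i))"

definition chromatic_index :: "('v, 'h) multigraph \<Rightarrow> ('h \<Rightarrow> int) \<Rightarrow> enat" where
  "chromatic_index G \<tau> = min (chromatic_index_par 0 G \<tau>) (chromatic_index_par 1 G \<tau>)"

end

theory Submission
  imports Defs
begin

text \<open>
  Negating \<open>\<tau>\<close> on all half-edges at a vertex (switching) negates all values seen there, so it
  neither creates nor removes conflicts. In a balanced signed graph some sequence of switchings
  makes every edge positive (\<open>balanced_switching\<close>). On a positive edge the two half-edges carry
  opposite values, so giving it one of the colors \<open>s, -s\<close> amounts to directing it. The edges
  colored from such a pair are free of conflicts if and only if every vertex has at most one
  outgoing and at most one incoming edge among them.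

  Hence \<open>k\<close> pairs suffice for a balanced signed graph of maximum degree at most \<open>2k\<close>. Direct the
  edges so that indegree and outdegree differ by at most one at every vertex
  (\<open>eulerian_orientation\<close>); both are then at most \<open>k\<close>. Splitting each vertex into an outgoing and
  an incoming copy gives a bipartite multigraph of maximum degree at most \<open>k\<close>, whose edges can
  be properly colored with \<open>k\<close> colors by Koenig's theorem (\<open>bipartite_edge_coloring\<close>). This is
  the argument for Petersen's 2-factor theorem, and the outcome is \<open>balanced_pair_coloring\<close>.

  The self-inverse color can be used exactly on the edges of a matching, so one self-inverse
  color and \<open>k\<close> pairs suffice if and only if there is a matching \<open>M\<close> such that \<open>G - M\<close> has
  maximum degree at most \<open>2k\<close>. Conversely the values at a vertex are pairwise different, so at least
  \<open>\<Delta>\<close> colors are necessary. If \<open>\<Delta>\<close> is even and positive, then \<open>\<Delta>/2\<close> pairs are enough.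
  If \<open>\<Delta>\<close> is odd, then \<open>\<Delta> + 1\<close> colors come as \<open>(\<Delta> + 1)/2\<close> pairs, and a coloring with \<open>\<Delta>\<close> colors
  has to use the self-inverse one, that is, a matching \<open>M\<close> with \<open>\<Delta>(G - M) = \<Delta> - 1\<close>.

  The bound is attained by a path with two edges and \<open>m \<ge> 1\<close> loops at each of its end vertices.
  Its maximum degree \<open>2m + 1\<close> is attained at the two end vertices only, and a matching, which
  contains no loops and at most one of the two path edges, misses one of them.
\<close>

section \<open>Simple paths and switching\<close>

lemma disjoint_eqI: "disjoint E \<Longrightarrow> e \<in> E \<Longrightarrow> e' \<in> E \<Longrightarrow> h \<in> e \<Longrightarrow> h \<in> e' \<Longrightarrow> e = e'"
  unfolding disjoint_def by blast

lemma finite_half_edges: "finite E \<Longrightarrow> \<forall>e\<in>E. card e = 2 \<Longrightarrow> finite (\<Union> E)"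
  by (rule finite_Union) (auto intro: card_ge_0_finite)

text \<open>
  A path from \<open>u\<close> is recorded by its edge set and its vertex set, since a circuit is given by
  such sets. It grows at its far end, by an edge of \<open>F\<close> to a vertex that it has not visited.
\<close>

inductive simple_path ::
  "('h \<Rightarrow> 'v) \<Rightarrow> 'h set set \<Rightarrow> 'v \<Rightarrow> 'v \<Rightarrow> 'h set set \<Rightarrow> 'v set \<Rightarrow> bool"
  for p :: "'h \<Rightarrow> 'v" and F :: "'h set set" and u :: 'v where
  trivial: "simple_path p F u u {} {u}"
| extend: "simple_path p F u v E W \<Longrightarrow> {h, h'} \<in> F \<Longrightarrow> p h = v \<Longrightarrow> p h' \<notin> W \<Longrightarrow>
    simple_path p F u (p h') (insert {h, h'} E) (insert (p h') W)"

lemma simple_path_basics: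
  assumes "simple_path p F u v E W"
  shows "u \<in> W" "v \<in> W" "finite W" "finite E" "E \<subseteq> F" "p ` \<Union> E \<subseteq> W"
    "W \<subseteq> insert u (p ` \<Union> E)"
  using assms by (induction rule: simple_path.induct) auto

text \<open>
  The initial segments of a path are paths. This is why a walk that returns to a visited vertex
  can be shortened.
\<close>

lemma simple_path_prefix:
  assumes "simple_path p F u v E W" "x \<in> W"
  shows "\<exists>E' W'. simple_path p F u x E' W'"
  using assms
proof (induction rule: simple_path.induct)
  case trivial
  then show ?case by (auto intro: simple_path.trivial)
next
  case (extend v E W h h')
  then show ?case using simple_path.extend[OF extend.hyps] by blast
qed

lemma simple_path_exists:
  assumes "(u, v) \<in> {(p h, p h') | h h'. {h, h'} \<in> F}\<^sup>*"
  shows "\<exists>E W. simple_path p F u v E W"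
  using assms
proof (induction rule: rtrancl_induct)
  case base
  show ?case by (intro exI) (rule simple_path.trivial)
next
  case (step y z)
  then obtain E W h h' where W: "simple_path p F u y E W"
    and h: "{h, h'} \<in> F" "y = p h" "z = p h'" by blast
  show ?case
  proof (cases "z \<in> W")
    case True
    then show ?thesis using simple_path_prefix[OF W] by blast
  next
    case False
    then show ?thesis using simple_path.extend[OF W h(1)] h by blast
  qed
qed

lemma card_half_edges_at_insert:
  assumes "finite (\<Union> E)" "a \<noteq> b" "a \<notin> \<Union> E" "b \<notin> \<Union> E"
  shows "card {h \<in> \<Union> (insert {a, b} E). p h = x} =
    card {h \<in> \<Union> E. p h = x} + of_bool (x = p a) + of_bool (x = p b)"
proof -
  have fin: "finite {h \<in> \<Union> E. p h = x}" by (rule finite_subset[OF _ assms(1)]) blast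
  have "{h \<in> \<Union> (insert {a, b} E). p h = x} =
      {h \<in> \<Union> E. p h = x} \<union> ({h. h = a \<and> p h = x} \<union> {h. h = b \<and> p h = x})"
    by auto
  also have "card \<dots> = card {h \<in> \<Union> E. p h = x} +
      card ({h. h = a \<and> p h = x} \<union> {h. h = b \<and> p h = x})"
    using assms by (intro card_Un_disjoint fin) auto
  also have "card ({h. h = a \<and> p h = x} \<union> {h. h = b \<and> p h = x}) =
      card {h. h = a \<and> p h = x} + card {h. h = b \<and> p h = x}"
    using assms by (intro card_Un_disjoint) auto
  also have "card {h. h = a \<and> p h = x} = of_bool (x = p a)"
    by (cases "x = p a") (auto cong: conj_cong)
  also have "card {h. h = b \<and> p h = x} = of_bool (x = p b)"
    by (cases "x = p b") (auto cong: conj_cong)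
  finally show ?thesis by simp
qed

text \<open>
  The end vertices lack one half-edge each; a trivial path lacks two at its only vertex. Counted in
  this way, an edge joining the two ends completes every degree to 2, also when that edge is a
  loop or is parallel to the only edge of the path.
\<close>

lemma simple_path_degree:
  assumes "simple_path p F u v E W" "\<forall>e\<in>F. card e = 2" "disjoint F" "x \<in> W"
  shows "card {h \<in> \<Union> E. p h = x} + of_bool (x = u) + of_bool (x = v) = 2"
  using assms
proof (induction arbitrary: x rule: simple_path.induct)
  case trivial
  then show ?case by simp
next
  case (extend v E W h h')
  note b = simple_path_basics[OF extend.hyps(1)]
  have "card {h, h'} = 2" using extend by blast
  then have ne: "h \<noteq> h'" by auto
  have fin: "finite (\<Union> E)"
    using b(4,5) extend.prems(1) by (intro finite_half_edges) auto
  have "{h, h'} \<notin> E" using b(6) extend.hyps(4) by auto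
  then have new: "h \<notin> \<Union> E" "h' \<notin> \<Union> E"
    using disjoint_eqI[OF extend.prems(2) extend.hyps(2)] b(5) by blast+
  have "p x \<noteq> p h'" if "x \<in> \<Union> E" for x
    using subsetD[OF b(6) imageI[OF that]] extend.hyps(4) by metis
  then have "{h \<in> \<Union> E. p h = p h'} = {}" unfolding Collect_empty_eq by metis
  then have none: "card {h \<in> \<Union> E. p h = p h'} = 0" by (simp only: card.empty)
  note ins = card_half_edges_at_insert[OF fin ne new, of p x]
  show ?case
  proof (cases "x = p h'")
    case True
    have "p h' \<noteq> u" "p h' \<noteq> p h" using extend.hyps(3,4) b(1,2) by metis+
    then show ?thesis using ins none True by simp
  next
    case False
    then have "x \<in> W" using extend.prems(3) by simp
    have "of_bool (x = p h) = (of_bool (x = v) :: nat)" "of_bool (x = p h') = (0 :: nat)"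
      using extend.hyps(3) False by simp_all
    then show ?thesis using ins extend.IH[OF extend.prems(1,2) \<open>x \<in> W\<close>] by linarith
  qed
qed

lemma simple_path_connected:
  assumes "simple_path p F u v E W" "x \<in> W"
  shows "(u, x) \<in> {(p h, p h') | h h'. {h, h'} \<in> E}\<^sup>*"
  using assms
proof (induction arbitrary: x rule: simple_path.induct)
  case trivial
  then show ?case by simp
next
  case (extend v E W h h')
  let ?A = "\<lambda>E. {(p h, p h') | h h'. {h, h'} \<in> E}"
  have sub: "(?A E)\<^sup>* \<subseteq> (?A (insert {h, h'} E))\<^sup>*" by (intro rtrancl_mono) blast
  have v: "(u, p h) \<in> (?A (insert {h, h'} E))\<^sup>*"
    using extend.IH[of v] simple_path_basics(2)[OF extend.hyps(1)] extend.hyps(3) sub by blast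
  have "(p h, p h') \<in> ?A (insert {h, h'} E)" by blast
  with v have "(u, p h') \<in> (?A (insert {h, h'} E))\<^sup>*" by (rule rtrancl_into_rtrancl)
  then show ?case using extend.IH extend.prems sub by blast
qed

text \<open>
  If \<open>s\<close> switches all edges of \<open>F\<close> to positive ones, the product of the signs along a path
  telescopes.
\<close>

lemma simple_path_sign:
  fixes s :: "'v \<Rightarrow> int"
  assumes "simple_path p F u v E W" "\<forall>v. s v \<in> {1, -1}"
    and "\<forall>h h'. {h, h'} \<in> F \<longrightarrow> sign \<tau> {h, h'} = s (p h) * s (p h')"
  shows "(\<Prod>e\<in>E. sign \<tau> e) = s u * s v"
  using assms
proof (induction rule: simple_path.induct)
  case trivial
  have "s u \<in> {1, -1}" using trivial by blast
  then show ?case by auto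
next
  case (extend v E W h h')
  note b = simple_path_basics[OF extend.hyps(1)]
  have "{h, h'} \<notin> E" using b(6) extend.hyps(4) by auto
  moreover have "sign \<tau> {h, h'} = s (p h) * s (p h')" using extend.hyps(2) extend.prems(2) by blast
  moreover have "s (p h) * s (p h) = 1" using extend.prems(1)[rule_format, of "p h"] by auto
  ultimately show ?case using extend b(4) by (simp add: algebra_simps)
qed

text \<open>
  Balance speaks of circuits as subgraphs; this is how a circuit is obtained from an edge
  whose ends are connected by other edges.
\<close>

lemma circuit_close_path:
  assumes G: "wf_multigraph G" and P: "simple_path (endpt G) F (endpt G b) (endpt G a) E W"
    and F: "F \<subseteq> edges G" and e: "{a, b} \<in> edges G" "{a, b} \<notin> F"
  defines "C \<equiv> \<lparr>verts = W, edges = insert {a, b} E, endpt = endpt G\<rparr>"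
  shows "subgraph C G" "circuit C"
proof -
  note P' = simple_path_basics[OF P]
  have two: "\<forall>e\<in>edges G. card e = 2" and dis: "disjoint (edges G)"
    and ends: "endpt G ` half_edges G \<subseteq> verts G"
    using G by (auto simp: wf_multigraph_def)
  have sub: "insert {a, b} E \<subseteq> edges G" using P'(5) F e by auto
  have ne: "a \<noteq> b" using two e(1) by fastforce
  have "{a, b} \<notin> E" using P'(5) e(2) by blast
  then have new: "a \<notin> \<Union> E" "b \<notin> \<Union> E"
    using disjoint_eqI[OF dis e(1)] sub by blast+
  have finE: "finite (\<Union> E)"
    using P'(4) sub two by (intro finite_half_edges) auto
  have "insert (endpt G b) (endpt G ` \<Union> E) \<subseteq> endpt G ` half_edges G"
    using sub e(1) by (auto simp: half_edges_def)
  then have WG: "W \<subseteq> verts G" using P'(7) ends by blast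
  have wf: "wf_multigraph C"
    unfolding wf_multigraph_def half_edges_def C_def
  proof (simp, intro conjI)
    show "finite W" "W \<noteq> {}" "finite E" "endpt G ` (\<Union> E) \<subseteq> W" "endpt G a \<in> W" "endpt G b \<in> W"
      using P' by auto
    show "card {a, b} = 2" "\<forall>e\<in>E. card e = 2" using sub two by auto
    show "disjoint (insert {a, b} E)" by (rule pairwise_subset[OF dis sub])
  qed
  then show "subgraph C G" using WG sub by (simp add: subgraph_def C_def)
  have "connected_graph C"
  proof -
    let ?A = "adjacency C"
    have "sym ?A"
    proof (rule symI)
      fix x y assume "(x, y) \<in> ?A"
      then obtain h h' where "{h', h} \<in> edges C" "x = endpt C h" "y = endpt C h'"
        unfolding adjacency_def by (auto simp: insert_commute)
      then show "(y, x) \<in> ?A" unfolding adjacency_def by blast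
    qed
    then have s: "sym (?A\<^sup>*)" by (rule sym_rtrancl)
    have "{(endpt G h, endpt G h') | h h'. {h, h'} \<in> E} \<subseteq> ?A" by (auto simp: adjacency_def C_def)
    then have r: "(endpt G b, x) \<in> ?A\<^sup>*" if "x \<in> W" for x
      using subsetD[OF rtrancl_mono simple_path_connected[OF P that]] by blast
    have "(x, y) \<in> ?A\<^sup>*" if "x \<in> W" "y \<in> W" for x y
      using symD[OF s r[OF that(1)]] r[OF that(2)] by (rule rtrancl_trans)
    then show ?thesis by (simp add: connected_graph_def C_def)
  qed
  moreover have "degree C x = 2" if "x \<in> W" for x
  proof -
    have "\<forall>e\<in>F. card e = 2" "disjoint F" using F two pairwise_subset[OF dis F] by auto
    note simple_path_degree[OF P this that]
    then show ?thesis
      using card_half_edges_at_insert[OF finE ne new, of "endpt G" x]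
      by (simp add: degree_def half_edges_at_def half_edges_def C_def)
  qed
  moreover have "verts C = W" by (simp add: C_def)
  ultimately show "circuit C" using wf unfolding circuit_def by blast
qed

text \<open>
  Harary's theorem, by induction on the number of edges. Suppose that \<open>s\<close> is a switching for
  \<open>F\<close> and an edge \<open>e\<close> is added. If the ends of \<open>e\<close> are connected in \<open>F\<close>, then \<open>e\<close> closes a circuit,
  and the sign of \<open>e\<close> is right because that circuit is positive. Otherwise \<open>s\<close> may be negated on
  the component of one end, which leaves all edges of \<open>F\<close> satisfied and corrects \<open>e\<close> if needed.
\<close>

lemma balanced_switching:
  assumes G: "signed_graph G \<tau>" and bal: "balanced G \<tau>"
  obtains s :: "'v \<Rightarrow> int" where "\<And>v. s v \<in> {1, -1}"
    and "\<And>h h'. {h, h'} \<in> edges (G :: ('v, 'h) multigraph) \<Longrightarrow> sign \<tau> {h, h'} = s (endpt G h) * s (endpt G h')"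
proof -
  let ?p = "endpt G"
  have wf: "wf_multigraph G" using G by (simp add: signed_graph_def)
  then have fin: "finite (edges G)" and two: "\<forall>e\<in>edges G. card e = 2"
    by (auto simp: wf_multigraph_def)
  have sg: "sign \<tau> e \<in> {1, -1}" if "e \<in> edges G" for e
  proof -
    have "card e = 2" using that two by blast
    then obtain a b where e: "e = {a, b}" "a \<noteq> b" by (auto simp: card_2_iff)
    have "\<tau> a \<in> {1, -1}" "\<tau> b \<in> {1, -1}"
      using G that e by (auto simp: signed_graph_def orientation_def half_edges_def Pi_iff)
    then show ?thesis using e by (auto simp: sign_def)
  qed
  have "\<exists>s :: 'v \<Rightarrow> int. (\<forall>v. s v \<in> {1, -1}) \<and>
      (\<forall>h h'. {h, h'} \<in> F \<longrightarrow> sign \<tau> {h, h'} = s (?p h) * s (?p h'))"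
    if "finite F" "F \<subseteq> edges G" for F
    using that
  proof (induction rule: finite_induct)
    case empty
    show ?case by (intro exI[of _ "\<lambda>_. 1"]) auto
  next
    case (insert e F)
    have "card e = 2" using insert.prems two by blast
    then obtain a b where e: "e = {a, b}" "a \<noteq> b" by (auto simp: card_2_iff)
    obtain s :: "'v \<Rightarrow> int" where s: "\<forall>v. s v \<in> {1, -1}"
      and sF: "\<forall>h h'. {h, h'} \<in> F \<longrightarrow> sign \<tau> {h, h'} = s (?p h) * s (?p h')"
      using insert by auto
    have sq: "s v * s v = 1" for v
      using s[rule_format, of v] by auto
    let ?A = "{(?p h, ?p h') | h h'. {h, h'} \<in> F}"
    have combine: "\<forall>h h'. {h, h'} \<in> insert e F \<longrightarrow> sign \<tau> {h, h'} = t (?p h) * t (?p h')"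
      if new: "sign \<tau> e = t (?p a) * t (?p b)"
        and old: "\<forall>h h'. {h, h'} \<in> F \<longrightarrow> sign \<tau> {h, h'} = t (?p h) * t (?p h')" for t :: "'v \<Rightarrow> int"
    proof (intro allI impI)
      fix h h' assume "{h, h'} \<in> insert e F"
      then consider "{h, h'} = e" | "{h, h'} \<in> F" by (elim insertE)
      then show "sign \<tau> {h, h'} = t (?p h) * t (?p h')"
      proof cases
        case 1
        then have "h = a \<and> h' = b \<or> h = b \<and> h' = a" using e(1) by (simp add: doubleton_eq_iff)
        then have "t (?p h) * t (?p h') = t (?p a) * t (?p b)" by (elim disjE) simp_all
        then show ?thesis using new 1 by simp
      qed (rule old[rule_format])
    qed
    show ?case
    proof (cases "(?p b, ?p a) \<in> ?A\<^sup>*")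
      case True
      then obtain E W where P: "simple_path ?p F (?p b) (?p a) E W"
        using simple_path_exists[OF True] by blast
      let ?C = "\<lparr>verts = W, edges = insert {a, b} E, endpt = ?p\<rparr>"
      have "subgraph ?C G" "circuit ?C"
        using circuit_close_path[OF wf P] insert e by auto
      then have "(\<Prod>e\<in>edges ?C. sign \<tau> e) > 0" using bal unfolding balanced_def by blast
      moreover have "e \<notin> E" "finite E" using simple_path_basics[OF P] insert.hyps by auto
      ultimately have "sign \<tau> e * (s (?p b) * s (?p a)) > 0"
        using simple_path_sign[OF P s sF] e by simp
      moreover have "sign \<tau> e \<in> {1, -1}" "s (?p a) \<in> {1, -1}" "s (?p b) \<in> {1, -1}"
        using sg insert.prems s by blast+
      ultimately have "sign \<tau> e = s (?p a) * s (?p b)" by auto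
      from s combine[OF this sF] show ?thesis by (intro exI[of _ s] conjI)
    next
      case False
      define t where "t = sign \<tau> e * s (?p a) * s (?p b)"
      define s' where "s' v = (if (?p b, v) \<in> ?A\<^sup>* then t * s v else s v)" for v
      have t: "t \<in> {1, -1}"
      proof -
        have "sign \<tau> e \<in> {1, -1}" "s (?p a) \<in> {1, -1}" "s (?p b) \<in> {1, -1}"
          using sg insert.prems s by blast+
        then show ?thesis unfolding t_def by auto
      qed
      have s': "s' v \<in> {1, -1}" for v
      proof -
        have "s v \<in> {1, -1}" using s by blast
        then show ?thesis using t by (auto simp: s'_def)
      qed
      have old: "sign \<tau> {h, h'} = s' (?p h) * s' (?p h')" if "{h, h'} \<in> F" for h h'
      proof -
        have "{h', h} \<in> F" using that by (simp only: insert_commute)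
        then have "(?p h, ?p h') \<in> ?A" "(?p h', ?p h) \<in> ?A" using that by blast+
        then have "(?p b, ?p h) \<in> ?A\<^sup>* \<longleftrightarrow> (?p b, ?p h') \<in> ?A\<^sup>*"
          by (meson rtrancl_into_rtrancl)
        then show ?thesis using sF that t by (auto simp: s'_def)
      qed
      have "sign \<tau> e = s' (?p a) * s' (?p b)"
      proof -
        have "s' (?p a) * s' (?p b) = sign \<tau> e * (s (?p a) * s (?p a)) * (s (?p b) * s (?p b))"
          using False by (simp add: s'_def t_def)
        then show ?thesis by (simp add: sq)
      qed
      moreover have "\<forall>h h'. {h, h'} \<in> F \<longrightarrow> sign \<tau> {h, h'} = s' (?p h) * s' (?p h')"
        by (intro allI impI) (rule old)
      ultimately have new: "\<forall>h h'. {h, h'} \<in> insert e F \<longrightarrow> sign \<tau> {h, h'} = s' (?p h) * s' (?p h')"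
        by (rule combine)
      show ?thesis by (rule exI[of _ s'], rule conjI, rule allI, rule s', rule new)
    qed
  qed
  from this[OF fin subset_refl] obtain s :: "'v \<Rightarrow> int" where s: "\<forall>v. s v \<in> {1, -1}"
    and sG: "\<forall>h h'. {h, h'} \<in> edges G \<longrightarrow> sign \<tau> {h, h'} = s (?p h) * s (?p h')"
    by (elim exE conjE)
  show thesis by (rule that[of s, OF s[rule_format] sG[rule_format]])
qed

section \<open>Eulerian orientations\<close>

lemma card_2_other:
  assumes "card e = 2" "b \<in> e"
  obtains a where "e = {a, b}" "a \<noteq> b"
  using assms by (auto simp: card_2_iff)

text \<open>
  Splitting off: if \<open>b\<close> and \<open>c\<close> are two half-edges at the same vertex, in edges \<open>ab\<close> and \<open>cd\<close>,
  replace these edges by the single edge \<open>ad\<close>. An orientation of \<open>ad\<close> is read as a directed walk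
  through \<open>a, b, c, d\<close>, which enters the common vertex once and leaves it once and so does not
  change its balance. When no two half-edges share a vertex, every orientation is good.
\<close>

lemma eulerian_orientation:
  assumes "finite E" "\<forall>e\<in>E. card e = 2" "disjoint E"
  shows "\<exists>s :: 'h \<Rightarrow> int. (\<forall>h. s h \<in> {1, -1}) \<and> (\<forall>e\<in>E. sum s e = 0) \<and>
    (\<forall>v. \<bar>\<Sum>h | h \<in> \<Union> E \<and> p h = (v :: 'v). s h\<bar> \<le> 1)"
  using assms
proof (induction "card E" arbitrary: E rule: less_induct)
  case less
  have finH: "finite (\<Union> E')" if "E' \<subseteq> E" for E'
    using less.prems(2) that finite_subset[OF that less.prems(1)] by (intro finite_half_edges) auto
  show ?case
  proof (cases "inj_on p (\<Union> E)")
    case True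
    have "\<forall>e\<in>E. \<exists>a. a \<in> e" using less.prems(2) by (metis card_2_iff' )
    then obtain f where f: "\<And>e. e \<in> E \<Longrightarrow> f e \<in> e" by metis
    \<comment> \<open>An arbitrary half-edge of each edge becomes the positive one.\<close>
    define s :: "'h \<Rightarrow> int" where "s h = (if h \<in> f ` E then 1 else -1)" for h
    have "sum s e = 0" if e: "e \<in> E" for e
    proof -
      obtain a b where ab: "e = {a, b}" "a \<noteq> b" using less.prems(2) e by (metis card_2_iff)
      have "x = f e" if "x \<in> e" "x \<in> f ` E" for x
      proof -
        obtain g where "g \<in> E" "x = f g" using \<open>x \<in> f ` E\<close> by blast
        then show ?thesis using disjoint_eqI[OF less.prems(3) e \<open>g \<in> E\<close> \<open>x \<in> e\<close>] f by blast
      qed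
      then have "h \<in> f ` E \<longleftrightarrow> h = f e" if "h \<in> e" for h using that e by blast
      then have "s h = (if h = f e then 1 else -1)" if "h \<in> e" for h using that by (simp add: s_def)
      then show ?thesis using f[OF e] ab by auto
    qed
    moreover have "\<bar>\<Sum>h | h \<in> \<Union> E \<and> p h = v. s h\<bar> \<le> 1" for v
    proof (cases "\<exists>h\<in>\<Union> E. p h = v")
      case True': True
      then obtain h where "h \<in> \<Union> E" "p h = v" by blast
      then have "{h \<in> \<Union> E. p h = v} = {h}" using True by (auto dest: inj_onD)
      then show ?thesis by (simp add: s_def)
    next
      case False
      then have "{h. h \<in> \<Union> E \<and> p h = v} = {}" by blast
      then show ?thesis by (simp only: sum.empty)
    qed
    ultimately show ?thesis by (intro exI[of _ s]) (auto simp: s_def)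
  next
    case False
    then obtain b c where bc: "b \<in> \<Union> E" "c \<in> \<Union> E" "p b = p c" "b \<noteq> c" by (auto simp: inj_on_def)
    have dis: "e = e'" if "e \<in> E" "e' \<in> E" "h \<in> e" "h \<in> e'" for e e' h
      using disjoint_eqI[OF less.prems(3) that] .
    \<comment> \<open>Since \<open>b\<close> and \<open>c\<close> lie at the same vertex, putting them back with opposite signs
      leaves all vertex sums unchanged.\<close>
    have extend: "\<bar>\<Sum>h | h \<in> \<Union> E \<and> p h = v. s h\<bar> \<le> 1"
      if s': "\<And>v. \<bar>\<Sum>h | h \<in> H' \<and> p h = v. s' h\<bar> \<le> 1" and H: "\<Union> E = insert b (insert c H')"
        "b \<notin> H'" "c \<notin> H'" and eq: "\<And>h. h \<in> H' \<Longrightarrow> s h = s' h" and zero: "s b + s c = 0"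
      for v H' and s s' :: "'h \<Rightarrow> int"
    proof -
      have fin: "finite H'" using finH[of E] H by auto
      have "(\<Sum>h | h \<in> \<Union> E \<and> p h = v. s h) = (\<Sum>h | h \<in> H' \<and> p h = v. s h)"
      proof (cases "p b = v")
        case True
        then have "{h. h \<in> \<Union> E \<and> p h = v} = insert b (insert c {h. h \<in> H' \<and> p h = v})"
          using H bc by auto
        then show ?thesis using H bc fin zero by simp
      next
        case False
        then have "{h. h \<in> \<Union> E \<and> p h = v} = {h. h \<in> H' \<and> p h = v}" using H bc by auto
        then show ?thesis by simp
      qed
      also have "\<dots> = (\<Sum>h | h \<in> H' \<and> p h = v. s' h)" using eq by (intro sum.cong) auto
      finally show ?thesis using s' by simp
    qed
    show ?thesis
    proof (cases "{b, c} \<in> E")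
      case True
      let ?E' = "E - {{b, c}}"
      have H: "\<Union> E = insert b (insert c (\<Union> ?E'))" "b \<notin> \<Union> ?E'" "c \<notin> \<Union> ?E'"
        using True dis by blast+
      have "card ?E' < card E" using True less.prems by (metis card_Diff1_less)
      moreover have "disjoint ?E'" using less.prems(3) by (meson Diff_subset pairwise_subset)
      ultimately obtain s' :: "'h \<Rightarrow> int" where s': "\<forall>h. s' h \<in> {1, -1}" "\<forall>e\<in>?E'. sum s' e = 0"
          "\<forall>v. \<bar>\<Sum>h | h \<in> \<Union> ?E' \<and> p h = v. s' h\<bar> \<le> 1"
        using less.hyps[of ?E'] less.prems by auto
      define s where "s = s'(b := 1, c := -1)"
      have eq: "s h = s' h" if "h \<in> \<Union> ?E'" for h using that H by (auto simp: s_def)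
      have zero: "s b + s c = 0" using bc by (simp add: s_def)
      have "sum s e = 0" if "e \<in> E" for e
      proof (cases "e = {b, c}")
        case True
        then show ?thesis using zero bc by simp
      next
        case False
        then have "sum s e = sum s' e" using that by (intro sum.cong) (auto intro!: eq)
        then show ?thesis using s' that False by simp
      qed
      then show ?thesis using s'(1) extend[OF s'(3)[rule_format] H eq zero]
        by (intro exI[of _ s]) (auto simp: s_def)
    next
      case False
      obtain e f where e: "e \<in> E" "b \<in> e" and f: "f \<in> E" "c \<in> f" using bc by blast
      obtain a where a: "e = {a, b}" "a \<noteq> b"
        using less.prems(2) e by (blast elim: card_2_other)
      obtain d where d: "f = {d, c}" "d \<noteq> c"
        using less.prems(2) f by (blast elim: card_2_other)
      have ef: "e \<noteq> f" using False a d bc e f by auto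
      then have abcd: "a \<noteq> c" "a \<noteq> d" "b \<noteq> d" "b \<noteq> c"
        using dis[OF e(1) f(1)] a d by auto
      let ?E' = "insert {a, d} (E - {e, f})"
      have rest: "h \<notin> g" if "h \<in> {a, b, c, d}" "g \<in> E - {e, f}" for h g
        using that dis[of e g h] dis[of f g h] e f a d by blast
      have H: "\<Union> E = insert b (insert c (\<Union> ?E'))" using e f a d by blast
      have H': "b \<notin> \<Union> ?E'" "c \<notin> \<Union> ?E'" using rest abcd a d by auto
      have "card ?E' < card E"
      proof -
        have "card {e, f} \<le> card E" using e f less.prems by (intro card_mono) auto
        then have "card (E - {e, f}) = card E - 2" "2 \<le> card E" using e f ef by (auto simp: card_Diff_subset)
        then show ?thesis using card_insert_le_m1[of "card E - 1" "E - {e, f}" "{a, d}"] by linarith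
      qed
      moreover have "disjoint ?E'"
        using rest dis unfolding disjoint_def by blast
      moreover have "\<forall>e\<in>?E'. card e = 2" "finite ?E'" using less.prems abcd by auto
      ultimately obtain s' :: "'h \<Rightarrow> int" where s': "\<forall>h. s' h \<in> {1, -1}" "\<forall>e\<in>?E'. sum s' e = 0"
          "\<forall>v. \<bar>\<Sum>h | h \<in> \<Union> ?E' \<and> p h = v. s' h\<bar> \<le> 1"
        using less.hyps[of ?E'] by blast
      have ad: "s' a + s' d = 0" using s'(2) abcd by simp
      define s where "s = s'(b := - s' a, c := - s' d)"
      have eq: "s h = s' h" if "h \<in> \<Union> ?E'" for h using that H' by (auto simp: s_def)
      have zero: "s b + s c = 0" using abcd ad by (simp add: s_def)
      have "sum s g = 0" if "g \<in> E" for g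
      proof -
        consider "g = e" | "g = f" | "g \<in> E - {e, f}" using \<open>g \<in> E\<close> by blast
        then show ?thesis
        proof cases
          case 3
          then have "sum s g = sum s' g" by (intro sum.cong) (auto intro!: eq)
          then show ?thesis using s' 3 by simp
        qed (use a d abcd in \<open>auto simp: s_def\<close>)
      qed
      moreover have "s h \<in> {1, -1}" for h
      proof -
        have "s' h \<in> {1, -1}" "s' a \<in> {1, -1}" "s' d \<in> {1, -1}" using s'(1) by blast+
        then show ?thesis by (auto simp: s_def)
      qed
      ultimately show ?thesis using extend[OF s'(3)[rule_format] H H' eq zero]
        by (intro exI[of _ s]) blast
    qed
  qed
qed

text \<open>
  If there were \<open>k + 1\<close> half-edges of one sign, there would be at least \<open>k\<close> of the other, hence
  more than \<open>2k\<close> altogether.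
\<close>

lemma orientation_degree_le:
  fixes s :: "'h \<Rightarrow> int"
  assumes "finite H" "\<And>h. s h \<in> {1, -1}" "\<bar>sum s H\<bar> \<le> 1" "card H \<le> 2 * k" "i \<in> {1, -1}"
  shows "card {h \<in> H. s h = i} \<le> k"
proof -
  let ?P = "{h \<in> H. s h = 1}" and ?N = "{h \<in> H. s h = -1}"
  have H: "H = ?P \<union> ?N" "?P \<inter> ?N = {}" using assms(2) by auto
  have fin: "finite ?P" "finite ?N" using assms(1) by auto
  have "card H = card ?P + card ?N" using H fin card_Un_disjoint by metis
  moreover have "sum s H = sum s ?P + sum s ?N" using H fin sum.union_disjoint by metis
  then have "sum s H = int (card ?P) - int (card ?N)" by simp
  ultimately show ?thesis using assms(3-5) by auto
qed

section \<open>Edge colorings of bipartite multigraphs\<close>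

text \<open>
  The edges that are reached from the vertex \<open>y\<close> on the right-hand side by alternating the colors
  \<open>\<alpha>\<close> and \<open>\<beta>\<close>, beginning with \<open>\<alpha>\<close>. The maps \<open>l\<close> and \<open>r\<close> give the two ends of an edge. As the sides are
  told apart by the maps, an \<open>\<alpha>\<close>-edge of the chain is always left through its left end and a
  \<open>\<beta>\<close>-edge through its right end.
\<close>

inductive_set kempe_chain ::
  "'e set \<Rightarrow> ('e \<Rightarrow> 'a) \<Rightarrow> ('e \<Rightarrow> 'b) \<Rightarrow> ('e \<Rightarrow> nat) \<Rightarrow> nat \<Rightarrow> nat \<Rightarrow> 'b \<Rightarrow> 'e set"
  for E l r c \<alpha> \<beta> y where
  start: "f \<in> E \<Longrightarrow> c f = \<alpha> \<Longrightarrow> r f = y \<Longrightarrow> f \<in> kempe_chain E l r c \<alpha> \<beta> y"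
| left: "f \<in> kempe_chain E l r c \<alpha> \<beta> y \<Longrightarrow> c f = \<alpha> \<Longrightarrow> g \<in> E \<Longrightarrow> c g = \<beta> \<Longrightarrow> l g = l f \<Longrightarrow>
    g \<in> kempe_chain E l r c \<alpha> \<beta> y"
| right: "f \<in> kempe_chain E l r c \<alpha> \<beta> y \<Longrightarrow> c f = \<beta> \<Longrightarrow> g \<in> E \<Longrightarrow> c g = \<alpha> \<Longrightarrow> r g = r f \<Longrightarrow>
    g \<in> kempe_chain E l r c \<alpha> \<beta> y"

definition proper_bipartite :: "'e set \<Rightarrow> ('e \<Rightarrow> 'a) \<Rightarrow> ('e \<Rightarrow> 'b) \<Rightarrow> ('e \<Rightarrow> nat) \<Rightarrow> bool" where
  "proper_bipartite E l r c \<longleftrightarrow>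
     (\<forall>f\<in>E. \<forall>g\<in>E. c f = c g \<longrightarrow> l f = l g \<or> r f = r g \<longrightarrow> f = g)"

text \<open>
  Let \<open>\<alpha>\<close> be missing at \<open>x\<close> and \<open>\<beta>\<close> be missing at \<open>y\<close>. The chain is closed under adjacency among
  \<open>\<alpha>\<close>- and \<open>\<beta>\<close>-edges: at the end through which an edge of the chain was entered, its predecessor is
  the only other candidate, and the first edge has no other candidate at \<open>y\<close> because \<open>\<beta>\<close> is
  missing there. So exchanging the two colors on the chain keeps the coloring proper. It frees \<open>\<alpha>\<close>
  at \<open>y\<close>. It does not bring \<open>\<alpha>\<close> to \<open>x\<close>: the chain reaches vertices on the left-hand side
  through \<open>\<alpha>\<close>-edges only, so it avoids \<open>x\<close>.
\<close>

lemma kempe_swap: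
  assumes proper: "proper_bipartite E l r c" and ab: "\<alpha> \<noteq> \<beta>"
    and x: "\<forall>f\<in>E. l f = x \<longrightarrow> c f \<noteq> \<alpha>" and y: "\<forall>f\<in>E. r f = y \<longrightarrow> c f \<noteq> \<beta>"
  defines "K \<equiv> kempe_chain E l r c \<alpha> \<beta> y"
  defines "c' \<equiv> \<lambda>f. if f \<in> K then if c f = \<alpha> then \<beta> else \<alpha> else c f"
  shows "proper_bipartite E l r c'" "\<forall>f\<in>E. l f = x \<or> r f = y \<longrightarrow> c' f \<noteq> \<alpha>"
proof -
  have KE: "f \<in> E \<and> (c f = \<alpha> \<or> c f = \<beta>)" if "f \<in> K" for f
    using that unfolding K_def by (induction rule: kempe_chain.induct) auto
  have uniq: "f = g" if "f \<in> E" "g \<in> E" "c f = c g" "l f = l g \<or> r f = r g" for f g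
    using proper that by (auto simp: proper_bipartite_def)
  have from_left: "\<exists>g\<in>K. c g = \<alpha> \<and> l g = l f" if "f \<in> K" "c f = \<beta>" for f
    using that ab unfolding K_def by (cases rule: kempe_chain.cases) auto
  have from_right: "\<exists>g\<in>K. c g = \<beta> \<and> r g = r f" if "f \<in> K" "c f = \<alpha>" "r f \<noteq> y" for f
    using that ab unfolding K_def by (cases rule: kempe_chain.cases) auto
  have closed: "g \<in> K" if f: "f \<in> K" and g: "g \<in> E" "c g \<in> {\<alpha>, \<beta>}" "l f = l g \<or> r f = r g" for f g
  proof (cases "c f = c g")
    case True
    then show ?thesis using uniq[of f g] KE that by auto
  next
    case ne: False
    show ?thesis
    proof (cases "c f = \<alpha>")
      case True
      then have cg: "c g = \<beta>" using ne g by auto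
      show ?thesis
      proof (cases "l f = l g")
        case True': True
        then show ?thesis using kempe_chain.left[OF f[unfolded K_def] True g(1) cg] by (simp add: K_def)
      next
        case False
        then have "r f = r g" using g by blast
        moreover then have "r f \<noteq> y" using y g cg by auto
        ultimately obtain g' where "g' \<in> K" "c g' = \<beta>" "r g' = r g" using from_right[OF f True] by auto
        then show ?thesis using uniq[of g' g] KE g cg by auto
      qed
    next
      case False
      then have cf: "c f = \<beta>" and cg: "c g = \<alpha>" using KE[OF f] ne g by auto
      show ?thesis
      proof (cases "r f = r g")
        case True
        then show ?thesis using kempe_chain.right[OF f[unfolded K_def] cf g(1) cg] by (simp add: K_def)
      next
        case False
        then obtain g' where "g' \<in> K" "c g' = \<alpha>" "l g' = l g" using from_left[OF f cf] g by auto
        then show ?thesis using uniq[of g' g] KE g cg by auto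
      qed
    qed
  qed
  have "f = g" if fg: "f \<in> E" "g \<in> E" "l f = l g \<or> r f = r g" and eq: "c' f = c' g" for f g
  proof -
    have "c' h \<in> {\<alpha>, \<beta>} \<longleftrightarrow> c h \<in> {\<alpha>, \<beta>}" for h using KE[of h] by (auto simp: c'_def)
    then have "c f \<in> {\<alpha>, \<beta>} \<longleftrightarrow> c g \<in> {\<alpha>, \<beta>}" using eq by metis
    then have "f \<in> K \<longleftrightarrow> g \<in> K" using closed[of f g] closed[of g f] KE fg by auto
    then have "c f = c g" using eq KE[of f] KE[of g] ab by (auto simp: c'_def split: if_splits)
    then show ?thesis using uniq fg by blast
  qed
  then show "proper_bipartite E l r c'" by (auto simp: proper_bipartite_def)
  show "\<forall>f\<in>E. l f = x \<or> r f = y \<longrightarrow> c' f \<noteq> \<alpha>"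
  proof (intro ballI impI)
    fix f assume f: "f \<in> E" "l f = x \<or> r f = y"
    show "c' f \<noteq> \<alpha>"
    proof (cases "f \<in> K")
      case True
      have "c f = \<alpha>"
      proof (rule ccontr)
        assume "c f \<noteq> \<alpha>"
        then have cf: "c f = \<beta>" using KE True by blast
        then have "l f = x" using f y by auto
        then show False using from_left[OF True cf] x KE by auto
      qed
      then show ?thesis using True ab by (simp add: c'_def)
    next
      case False
      then show ?thesis using f x kempe_chain.start[of f E c \<alpha> r y l \<beta>]
        by (auto simp: c'_def K_def)
    qed
  qed
qed

text \<open>
  Koenig's edge coloring theorem. A new edge sees fewer than \<open>k\<close> other edges at each of its ends,
  so a color is missing at each end, and a Kempe exchange makes the two missing colors agree.
\<close>

lemma bipartite_edge_coloring:
  assumes "finite E" "\<And>x. card {e \<in> E. l e = x} \<le> k" "\<And>y. card {e \<in> E. r e = y} \<le> k"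
  shows "\<exists>c. c \<in> E \<rightarrow> {..<k} \<and> proper_bipartite E l r c"
  using assms
proof (induction rule: finite_induct)
  case empty
  then show ?case by (auto simp: proper_bipartite_def)
next
  case (insert e E)
  have mono: "card {f \<in> E. P f} \<le> card {f \<in> insert e E. P f}" for P
    using insert.hyps by (intro card_mono) auto
  then have "\<exists>c. c \<in> E \<rightarrow> {..<k} \<and> proper_bipartite E l r c"
    using insert by (meson le_trans)
  then obtain c where c: "c \<in> E \<rightarrow> {..<k}" "proper_bipartite E l r c" by blast
  have missing: "\<exists>\<alpha><k. \<forall>f\<in>E. P f \<longrightarrow> c f \<noteq> \<alpha>" if "card {f \<in> insert e E. P f} \<le> k" "P e" for P
  proof (rule ccontr)
    assume "\<not> ?thesis"
    then have "{..<k} \<subseteq> c ` {f \<in> E. P f}" by auto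
    then have "k \<le> card {f \<in> E. P f}"
      using insert.hyps surj_card_le[of "{f \<in> E. P f}" "{..<k}" c] by auto
    moreover have "{f \<in> insert e E. P f} = insert e {f \<in> E. P f}" using that by auto
    ultimately show False using that insert.hyps by simp
  qed
  obtain \<alpha> where \<alpha>: "\<alpha> < k" "\<forall>f\<in>E. l f = l e \<longrightarrow> c f \<noteq> \<alpha>"
    using missing[of "\<lambda>f. l f = l e"] insert.prems by auto
  obtain \<beta> where \<beta>: "\<beta> < k" "\<forall>f\<in>E. r f = r e \<longrightarrow> c f \<noteq> \<beta>"
    using missing[of "\<lambda>f. r f = r e"] insert.prems by auto
  obtain c' where c': "c' \<in> E \<rightarrow> {..<k}" "proper_bipartite E l r c'"
    and free: "\<forall>f\<in>E. l f = l e \<or> r f = r e \<longrightarrow> c' f \<noteq> \<alpha>"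
  proof (cases "\<alpha> = \<beta>")
    case True
    then show ?thesis using that[OF c] \<alpha> \<beta> by blast
  next
    case False
    show ?thesis
      using kempe_swap[OF c(2) False \<alpha>(2) \<beta>(2)] c(1) \<alpha>(1) \<beta>(1)
      by (intro that) (auto simp: Pi_iff)
  qed
  have "proper_bipartite (insert e E) l r (c'(e := \<alpha>))"
    using c'(2) free insert.hyps unfolding proper_bipartite_def by auto
  moreover have "c'(e := \<alpha>) \<in> insert e E \<rightarrow> {..<k}" using c'(1) \<alpha>(1) by auto
  ultimately show ?case by blast
qed

section \<open>Colorings of balanced signed graphs\<close>

lemma color_set_split: "color_set t k = Zero ` {..<t} \<union> color_set 0 k"
  by (auto simp: color_set_def)

lemma act_in_color_set: "act \<epsilon> c \<in> color_set t k \<longleftrightarrow> c \<in> color_set t k"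
  by (cases c) (auto simp: act_def color_set_def)

text \<open>
  The statement is about an edge set \<open>F\<close> because, besides the whole graph, it is needed for the graph
  without a matching.
\<close>

lemma balanced_pair_coloring:
  assumes G: "signed_graph G \<tau>" and bal: "balanced G \<tau>" and F: "F \<subseteq> edges G"
    and deg: "\<And>v. card {h \<in> \<Union> F. endpt G h = v} \<le> 2 * k"
  shows "\<exists>c. c \<in> F \<rightarrow> color_set 0 k \<and> (\<forall>e\<in>F. \<forall>f\<in>F. \<forall>h\<in>e. \<forall>h'\<in>f.
    h \<noteq> h' \<longrightarrow> endpt G h = endpt G h' \<longrightarrow> act (\<tau> h) (c e) \<noteq> act (\<tau> h') (c f))"
proof -
  let ?p = "endpt G"
  have wf: "wf_multigraph G" using G by (simp add: signed_graph_def)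
  then have fin: "finite F" and two: "\<forall>e\<in>F. card e = 2" and dis: "disjoint F"
    using F by (auto simp: wf_multigraph_def intro: finite_subset pairwise_subset)
  have \<tau>: "\<tau> h \<in> {1, -1}" if "h \<in> e" "e \<in> F" for h e
  proof -
    have "h \<in> half_edges G" using that F by (auto simp: half_edges_def)
    then show ?thesis using G unfolding signed_graph_def orientation_def by blast
  qed
  have finH: "finite (\<Union> F)" using fin two by (rule finite_half_edges)
  obtain S :: "_ \<Rightarrow> int" where S: "\<And>v. S v \<in> {1, -1}"
    and switch: "\<And>h h'. {h, h'} \<in> edges G \<Longrightarrow> sign \<tau> {h, h'} = S (?p h) * S (?p h')"
    using balanced_switching[OF G bal] by blast
  obtain s :: "_ \<Rightarrow> int" where s: "\<And>h. s h \<in> {1, -1}" and opp: "\<forall>e\<in>F. sum s e = 0"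
    and even: "\<And>v. \<bar>\<Sum>h | h \<in> \<Union> F \<and> ?p h = v. s h\<bar> \<le> 1"
    using eulerian_orientation[OF fin two dis] by metis
  have "\<exists>a b. e = {a, b} \<and> a \<noteq> b \<and> s a = 1 \<and> s b = -1" if e: "e \<in> F" for e
  proof -
    have "card e = 2" using two e by blast
    then obtain a b where ab: "e = {a, b}" "a \<noteq> b" by (auto simp: card_2_iff)
    then have "s a + s b = 0" using opp e by auto
    moreover have "s a \<in> {1, -1}" using s by blast
    ultimately have "s a = 1 \<and> s b = -1 \<or> s b = 1 \<and> s a = -1" by auto
    then show ?thesis using ab by (metis insert_commute)
  qed
  then have "\<forall>e\<in>F. \<exists>a b. e = {a, b} \<and> a \<noteq> b \<and> s a = 1 \<and> s b = -1" by (intro ballI)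
  then obtain l where "\<forall>e\<in>F. \<exists>b. e = {l e, b} \<and> l e \<noteq> b \<and> s (l e) = 1 \<and> s b = -1"
    by (rule bchoice[THEN exE])
  then obtain r where "\<forall>e\<in>F. e = {l e, r e} \<and> l e \<noteq> r e \<and> s (l e) = 1 \<and> s (r e) = -1"
    by (rule bchoice[THEN exE])
  note lr' = bspec[OF this]
  note ends = lr'[THEN conjunct1]
    and lr = lr'[THEN conjunct2, THEN conjunct1]
    lr'[THEN conjunct2, THEN conjunct2, THEN conjunct1] lr'[THEN conjunct2, THEN conjunct2, THEN conjunct2]
  have mem: "l e \<in> e" "r e \<in> e" if "e \<in> F" for e
    by (rule ssubst[OF ends[OF that]], blast)+
  have either: "h = l e \<or> h = r e" if "h \<in> e" "e \<in> F" for h e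
    using that(1) by (subst (asm) ends[OF that(2)]) simp
  have fiber: "card {e \<in> F. ?p (g e) = v} \<le> k"
    if g: "\<And>e. e \<in> F \<Longrightarrow> g e \<in> e" "\<And>e. e \<in> F \<Longrightarrow> s (g e) = i" and i: "i \<in> {1, -1}" for g i v
  proof -
    have "inj_on g {e \<in> F. ?p (g e) = v}"
    proof (rule inj_onI)
      fix e f assume "e \<in> {e \<in> F. ?p (g e) = v}" "f \<in> {e \<in> F. ?p (g e) = v}" and eq: "g e = g f"
      then have "e \<in> F" "f \<in> F" by simp_all
      then show "e = f"
        using disjoint_eqI[OF dis \<open>e \<in> F\<close> \<open>f \<in> F\<close> g(1)[OF \<open>e \<in> F\<close>]] g(1)[OF \<open>f \<in> F\<close>]
        by (simp only: eq)
    qed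
    moreover have "g ` {e \<in> F. ?p (g e) = v} \<subseteq> {h \<in> {h \<in> \<Union> F. ?p h = v}. s h = i}"
      using g by auto
    ultimately have "card {e \<in> F. ?p (g e) = v} \<le> card {h \<in> {h \<in> \<Union> F. ?p h = v}. s h = i}"
      by (rule card_inj_on_le) (rule finite_subset[OF _ finH], blast)
    also have "\<dots> \<le> k"
      by (rule orientation_degree_le[OF _ s even deg i]) (rule finite_subset[OF _ finH], blast)
    finally show ?thesis .
  qed
  have "card {e \<in> F. ?p (l e) = v} \<le> k" "card {e \<in> F. ?p (r e) = v} \<le> k" for v
    using fiber[of l 1] fiber[of r "-1"] mem lr(2,3) by simp_all
  then obtain c where c: "c \<in> F \<rightarrow> {..<k}" "proper_bipartite F (\<lambda>e. ?p (l e)) (\<lambda>e. ?p (r e)) c"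
    using bipartite_edge_coloring[OF fin, of "\<lambda>e. ?p (l e)" k "\<lambda>e. ?p (r e)"] by blast
  \<comment> \<open>The color of an edge is fixed by the condition that, after switching, its positive half-edge
    \<open>l e\<close> shows \<open>Plus (c e)\<close>. Its other half-edge then shows \<open>Minus (c e)\<close>, as the edge has become
    positive.\<close>
  define col where "col e = act (\<tau> (l e) * S (?p (l e))) (Plus (c e))" for e
  have col: "act (\<tau> h) (col e) = act (S (?p h) * s h) (Plus (c e))" if e: "e \<in> F" and h: "h \<in> e" for e h
  proof -
    have "sign \<tau> {l e, r e} = S (?p (l e)) * S (?p (r e))"
      by (rule switch) (use F e ends[OF e] in \<open>metis subsetD\<close>)
    then have "- (\<tau> (l e) * \<tau> (r e)) = S (?p (l e)) * S (?p (r e))"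
      using lr(1)[OF e] by (simp add: sign_def)
    moreover have "\<tau> (l e) \<in> {1, -1}" "\<tau> (r e) \<in> {1, -1}" using \<tau> e mem by blast+
    moreover have "S (?p (l e)) \<in> {1, -1}" "S (?p (r e)) \<in> {1, -1}" using S by blast+
    moreover have "h = l e \<or> h = r e" using either[OF h e] .
    ultimately show ?thesis using lr(2,3)[OF e] by (auto simp: col_def act_def)
  qed
  have "act (\<tau> h) (col e) \<noteq> act (\<tau> h') (col f)"
    if ef: "e \<in> F" "f \<in> F" and h: "h \<in> e" "h' \<in> f" "h \<noteq> h'" "?p h = ?p h'" for e f h h'
  proof
    assume "act (\<tau> h) (col e) = act (\<tau> h') (col f)"
    then have "act (S (?p h) * s h) (Plus (c e)) = act (S (?p h) * s h') (Plus (c f))"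
      using col ef h by simp
    moreover have "S (?p h) \<in> {1, -1}" "s h \<in> {1, -1}" "s h' \<in> {1, -1}" using S s by blast+
    ultimately have eq: "s h = s h'" "c e = c f" by (auto simp: act_def)
    have "h = l e \<and> h' = l f \<or> h = r e \<and> h' = r f"
    proof -
      have "h = l e \<or> h = r e" "h' = l f \<or> h' = r f" using either h ef by blast+
      then show ?thesis using eq(1) lr(2)[OF ef(1)] lr(2)[OF ef(2)] lr(3)[OF ef(1)] lr(3)[OF ef(2)] by auto
    qed
    then have "e = f" "h = l e \<and> h' = l f \<or> h = r e \<and> h' = r f"
      using c(2) eq(2) ef h unfolding proper_bipartite_def by auto
    then show False using h by auto
  qed
  moreover have "col e \<in> color_set 0 k" if "e \<in> F" for e
    unfolding col_def act_in_color_set using c(1) that by (auto simp: color_set_def)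
  ultimately show ?thesis by (intro exI[of _ col]) blast
qed

lemma half_edges_at_delete:
  "half_edges_at (delete_edges G M) v = {h \<in> \<Union> (edges G - M). endpt G h = v}"
  by (simp add: half_edges_at_def half_edges_def delete_edges_def)

lemma wf_finite_half_edges: "wf_multigraph G \<Longrightarrow> finite (half_edges G)"
  unfolding wf_multigraph_def half_edges_def by (blast intro: finite_half_edges)

text \<open>
  A half-edge with a self-inverse color never conflicts with one whose color comes from a pair,
  so the matching may be colored independently of the rest.
\<close>

lemma balanced_coloring:
  assumes G: "signed_graph G \<tau>" and bal: "balanced G \<tau>" and M: "matching G M"
    and deg: "max_degree (delete_edges G M) \<le> 2 * k" and t: "M \<noteq> {} \<Longrightarrow> t > 0"
    and tk: "t > 0 \<or> k > 0"
  shows "\<exists>c. coloring G \<tau> t k c"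
proof -
  let ?p = "endpt G" and ?F = "edges G - M"
  have wf: "wf_multigraph G" using G by (simp add: signed_graph_def)
  have "card {h \<in> \<Union> ?F. ?p h = v} \<le> 2 * k" for v
  proof (cases "v \<in> verts G")
    case True
    have "degree (delete_edges G M) v \<le> max_degree (delete_edges G M)"
      using wf True by (auto simp: max_degree_def delete_edges_def wf_multigraph_def)
    then show ?thesis using deg by (simp add: degree_def half_edges_at_delete)
  next
    case False
    then have "{h \<in> \<Union> ?F. ?p h = v} = {}" using wf by (auto simp: wf_multigraph_def half_edges_def)
    then show ?thesis by (metis card.empty le0)
  qed
  then obtain c where c: "c \<in> ?F \<rightarrow> color_set 0 k"
    and ok: "\<forall>e\<in>?F. \<forall>f\<in>?F. \<forall>h\<in>e. \<forall>h'\<in>f. h \<noteq> h' \<longrightarrow> ?p h = ?p h' \<longrightarrow> act (\<tau> h) (c e) \<noteq> act (\<tau> h') (c f)"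
    using balanced_pair_coloring[OF G bal, of ?F k] by blast
  define d where "d e = (if e \<in> M then Zero 0 else c e)" for e
  have z: "act \<epsilon> (Zero 0) = Zero 0" for \<epsilon> by (simp add: act_def)
  have nz: "act \<epsilon> (c e) \<noteq> Zero 0" if "e \<in> ?F" for e \<epsilon>
    using c that act_in_color_set[of \<epsilon> "c e" 0 k] by (auto simp: color_set_def)
  have "act (\<tau> h) (d e) \<noteq> act (\<tau> h') (d f)"
    if "e \<in> edges G" "f \<in> edges G" "h \<in> e" "h' \<in> f" "h \<noteq> h'" "?p h = ?p h'" for e f h h'
  proof (cases "e \<in> M \<and> f \<in> M")
    case True
    then show ?thesis using M that by (auto simp: matching_def inj_on_def)
  next
    case False
    then show ?thesis using that ok z nz[of e] nz[of f] by (auto simp: d_def) metis+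
  qed
  moreover have "d \<in> edges G \<rightarrow> color_set t k"
  proof (rule Pi_I)
    fix e assume e: "e \<in> edges G"
    show "d e \<in> color_set t k"
    proof (cases "e \<in> M")
      case True
      then show ?thesis using t by (auto simp: d_def color_set_def)
    next
      case False
      then have "c e \<in> color_set 0 k" using c e by blast
      then show ?thesis using False by (auto simp: d_def color_set_split[of t])
    qed
  qed
  ultimately have "coloring G \<tau> t k d" using tk by (auto simp: coloring_def half_edges_at_def)
  then show ?thesis by blast
qed

section \<open>Color classes and degrees\<close>

lemma coloringD:
  assumes G: "wf_multigraph G" and c: "coloring G \<tau> t k c"
    and e: "e \<in> edges G" "f \<in> edges G" "h \<in> e" "h' \<in> f" "h \<noteq> h'" "endpt G h = endpt G h'"
  shows "act (\<tau> h) (c e) \<noteq> act (\<tau> h') (c f)"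
proof -
  have "h \<in> half_edges G" "h' \<in> half_edges G" using e by (auto simp: half_edges_def)
  moreover from this have "endpt G h \<in> verts G" using G by (auto simp: wf_multigraph_def)
  ultimately have "h \<in> e \<inter> half_edges_at G (endpt G h)" "h' \<in> f \<inter> half_edges_at G (endpt G h)"
    using e by (auto simp: half_edges_at_def)
  then show ?thesis using c e(1,2,5) \<open>endpt G h \<in> verts G\<close> unfolding coloring_def by blast
qed

text \<open>
  The half-edges at a vertex show pairwise different values. The hypothesis that \<open>C\<close> is closed under
  the action ensures that these values stay among the colors in \<open>C\<close>.
\<close>

lemma coloring_card_le:
  assumes G: "wf_multigraph G" and c: "coloring G \<tau> t k c"
    and F: "F \<subseteq> edges G" and C: "c ` F \<subseteq> C" "\<And>\<epsilon> x. x \<in> C \<Longrightarrow> act \<epsilon> x \<in> C" "finite C"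
  shows "card {h \<in> \<Union> F. endpt G h = v} \<le> card C"
proof -
  let ?H = "{h \<in> \<Union> F. endpt G h = v}"
  have "\<forall>h\<in>?H. \<exists>e. e \<in> F \<and> h \<in> e" by blast
  then obtain e where e: "\<And>h. h \<in> ?H \<Longrightarrow> e h \<in> F \<and> h \<in> e h" by metis
  have "inj_on (\<lambda>h. act (\<tau> h) (c (e h))) ?H"
  proof (rule inj_onI, rule ccontr)
    fix h h' assume h: "h \<in> ?H" "h' \<in> ?H" "act (\<tau> h) (c (e h)) = act (\<tau> h') (c (e h'))" "h \<noteq> h'"
    have "e h \<in> edges G" "e h' \<in> edges G" "h \<in> e h" "h' \<in> e h'" "endpt G h = endpt G h'"
      using e[OF h(1)] e[OF h(2)] h(1,2) F by auto
    then show False using coloringD[OF G c] h(3,4) by blast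
  qed
  moreover have "(\<lambda>h. act (\<tau> h) (c (e h))) ` ?H \<subseteq> C" using e C by blast
  ultimately show ?thesis using C(3) by (rule card_inj_on_le)
qed

lemma max_degree_le_iff:
  assumes "wf_multigraph G"
  shows "max_degree G \<le> n \<longleftrightarrow> (\<forall>v\<in>verts G. degree G v \<le> n)"
  using assms by (auto simp: max_degree_def wf_multigraph_def)

lemma wf_delete_edges: "wf_multigraph G \<Longrightarrow> wf_multigraph (delete_edges G M)"
  unfolding wf_multigraph_def delete_edges_def half_edges_def
  by (auto intro: pairwise_subset)

lemma finite_color_set: "finite (color_set t k)"
  by (simp add: color_set_def)

lemma max_degree_le_colors:
  assumes G: "wf_multigraph G" and c: "coloring G \<tau> t k c"
  shows "max_degree G \<le> t + 2 * k"
proof -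
  have "degree G v \<le> card (color_set t k)" if v: "v \<in> verts G" for v
    using coloring_card_le[OF G c, of "edges G" "color_set t k"] c
    by (auto simp: degree_def half_edges_at_def half_edges_def coloring_def act_in_color_set finite_color_set)
  then show ?thesis using G by (simp add: max_degree_le_iff card_color_set)
qed

text \<open>
  Two half-edges of color \<open>Zero 0\<close> at one vertex would conflict whatever their orientation. The
  remaining half-edges at a vertex have only the \<open>2k\<close> other values.
\<close>

lemma coloring_zero_class:
  assumes G: "wf_multigraph G" and c: "coloring G \<tau> 1 k c"
  defines "M \<equiv> {e \<in> edges G. c e = Zero 0}"
  shows "matching G M" "max_degree (delete_edges G M) \<le> 2 * k"
proof -
  have "h = h'" if h: "h \<in> \<Union> M" "h' \<in> \<Union> M" and eq: "endpt G h = endpt G h'" for h h'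
  proof -
    obtain e f where ef: "e \<in> M" "f \<in> M" "h \<in> e" "h' \<in> f" using h by blast
    then have "e \<in> edges G" "f \<in> edges G" "c e = Zero 0" "c f = Zero 0" by (auto simp: M_def)
    then have "act (\<tau> h) (c e) = act (\<tau> h') (c f)" by (simp add: act_def)
    then show ?thesis
      using coloringD[OF G c \<open>e \<in> edges G\<close> \<open>f \<in> edges G\<close> ef(3,4)] eq by blast
  qed
  then show "matching G M" by (auto simp: matching_def M_def inj_on_def)
  have "degree (delete_edges G M) v \<le> card (color_set 0 k)" if v: "v \<in> verts G" for v
  proof -
    have "c ` (edges G - M) \<subseteq> color_set 0 k"
      using c by (auto simp: coloring_def M_def color_set_split[of "Suc 0"])
    then show ?thesis
      using coloring_card_le[OF G c, of "edges G - M" "color_set 0 k"]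
      by (simp add: degree_def half_edges_at_delete act_in_color_set finite_color_set)
  qed
  then show "max_degree (delete_edges G M) \<le> 2 * k"
    using wf_delete_edges[OF G] by (simp add: max_degree_le_iff card_color_set) (simp add: delete_edges_def)
qed

lemma degree_delete_matching:
  assumes G: "wf_multigraph G" and M: "matching G M"
  shows "degree G v \<le> degree (delete_edges G M) v + 1" "degree (delete_edges G M) v \<le> degree G v"
proof -
  let ?D = "half_edges_at (delete_edges G M) v" and ?N = "{h \<in> \<Union> M. endpt G h = v}"
  have fin: "finite (half_edges_at G v)"
    using wf_finite_half_edges[OF G] by (simp add: half_edges_at_def)
  have D: "?D \<subseteq> half_edges_at G v"
    unfolding half_edges_at_delete by (auto simp: half_edges_at_def half_edges_def)
  then show "degree (delete_edges G M) v \<le> degree G v"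
    unfolding degree_def using fin by (rule card_mono[rotated])
  have N: "?N \<subseteq> half_edges_at G v"
    using M by (auto simp: matching_def half_edges_at_def half_edges_def)
  have "x = y" if "x \<in> ?N" "y \<in> ?N" for x y
    using M that unfolding matching_def by (auto dest: inj_onD)
  then have "card ?N \<le> 1" using finite_subset[OF N fin] by (intro card_le_Suc0_iff_eq[THEN iffD2, folded One_nat_def]) auto
  moreover have "half_edges_at G v \<subseteq> ?D \<union> ?N"
    unfolding half_edges_at_delete by (auto simp: half_edges_at_def half_edges_def)
  then have "card (half_edges_at G v) \<le> card (?D \<union> ?N)"
    using D N fin by (intro card_mono) (auto intro: finite_subset)
  ultimately show "degree G v \<le> degree (delete_edges G M) v + 1"
    unfolding degree_def using card_Un_le[of ?D ?N] by linarith
qed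

lemma max_degree_delete_matching:
  assumes G: "wf_multigraph G" and M: "matching G M"
  shows "max_degree G \<le> max_degree (delete_edges G M) + 1" "max_degree (delete_edges G M) \<le> max_degree G"
proof -
  let ?D = "delete_edges G M"
  note wfD = wf_delete_edges[OF G, of M]
  have vD: "verts ?D = verts G" by (simp add: delete_edges_def)
  then have le: "degree G v \<le> max_degree G" "degree ?D v \<le> max_degree ?D" if "v \<in> verts G" for v
    using max_degree_le_iff[OF G, of "max_degree G"] max_degree_le_iff[OF wfD, of "max_degree ?D"] that by auto
  show "max_degree G \<le> max_degree ?D + 1"
    unfolding max_degree_le_iff[OF G] using degree_delete_matching(1)[OF G M] le(2)
    by (meson add_le_mono1 le_trans)
  show "max_degree ?D \<le> max_degree G"
    unfolding max_degree_le_iff[OF wfD] vD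
    using degree_delete_matching(2)[OF G M] le(1) by (meson le_trans)
qed

section \<open>The chromatic index\<close>

lemma chromatic_index_le_iff:
  "chromatic_index G \<tau> \<le> enat n \<longleftrightarrow> (\<exists>i\<in>{0, 1}. \<exists>k c. coloring G \<tau> i k c \<and> 2 * k + i \<le> n)"
proof -
  have "chromatic_index_par i G \<tau> \<le> enat n \<longleftrightarrow> (\<exists>k c. coloring G \<tau> i k c \<and> 2 * k + i \<le> n)" for i
  proof -
    have "chromatic_index_par i G \<tau> \<le> enat n \<longleftrightarrow> chromatic_index_par i G \<tau> < enat (Suc n)"
      by (cases "chromatic_index_par i G \<tau>") auto
    also have "\<dots> \<longleftrightarrow> (\<exists>k c. coloring G \<tau> i k c \<and> 2 * k + i \<le> n)"
      unfolding chromatic_index_par_def INF_less_iff by (auto simp: less_Suc_eq_le)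
    finally show ?thesis .
  qed
  then show ?thesis by (auto simp: chromatic_index_def min_le_iff_disj)
qed

lemma max_degree_le_chromatic_index:
  assumes "wf_multigraph G"
  shows "enat (max_degree G) \<le> chromatic_index G \<tau>"
proof (cases "chromatic_index G \<tau>")
  case (enat n)
  then obtain i k c where "coloring G \<tau> i k c" "2 * k + i \<le> n"
    using chromatic_index_le_iff[of G \<tau> n] by auto
  then show ?thesis using max_degree_le_colors[OF assms] enat by force
qed simp

lemma max_degree_pos:
  assumes G: "wf_multigraph G" and ne: "edges G \<noteq> {}"
  shows "max_degree G > 0"
proof -
  obtain e where e: "e \<in> edges G" using ne by blast
  then have "card e = 2" using G by (auto simp: wf_multigraph_def)
  then obtain h where "h \<in> e" by fastforce
  then have h: "h \<in> half_edges G" using e by (auto simp: half_edges_def)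
  then have v: "endpt G h \<in> verts G" using G by (auto simp: wf_multigraph_def)
  have "h \<in> half_edges_at G (endpt G h)" using h by (simp add: half_edges_at_def)
  moreover have "finite (half_edges_at G (endpt G h))"
    using wf_finite_half_edges[OF G] by (simp add: half_edges_at_def)
  ultimately have "degree G (endpt G h) > 0" by (auto simp: degree_def card_gt_0_iff)
  moreover have "degree G (endpt G h) \<le> max_degree G" using max_degree_le_iff[OF G] v by blast
  ultimately show ?thesis by linarith
qed

lemma matching_empty: "matching G {}" by (simp add: matching_def)

lemma delete_edges_empty: "delete_edges G {} = G" by (simp add: delete_edges_def)

text \<open>
  For even maximum degree the self-inverse color is taken although pairs alone suffice for a
  positive degree: this treats an edgeless graph as well, where at least one color is required.
\<close>

lemma balanced_chromatic_index_le:
  assumes G: "signed_graph G \<tau>" and bal: "balanced G \<tau>"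
  shows "chromatic_index G \<tau> \<le> enat (max_degree G + 1)"
proof (cases "even (max_degree G)")
  case True
  then obtain k where k: "max_degree G = 2 * k" by blast
  have "\<exists>c. coloring G \<tau> 1 k c"
    using balanced_coloring[OF G bal matching_empty, of k 1] k by (simp add: delete_edges_empty)
  then show ?thesis using k by (auto simp: chromatic_index_le_iff)
next
  case False
  then obtain k where k: "max_degree G = 2 * k + 1" by (blast elim: oddE)
  have "\<exists>c. coloring G \<tau> 0 (k + 1) c"
    using balanced_coloring[OF G bal matching_empty, of "k + 1" 0] k by (simp add: delete_edges_empty)
  then have "\<exists>k' c. coloring G \<tau> 0 k' c \<and> 2 * k' + 0 \<le> max_degree G + 1"
    using k by (intro exI[of _ "k + 1"]) auto
  then show ?thesis by (subst chromatic_index_le_iff) blast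
qed

text \<open>
  For odd maximum degree \<open>\<Delta>\<close>, a matching lowers the maximum degree by at most one, so an even
  maximum degree of \<open>G - M\<close> can only be \<open>\<Delta> - 1\<close>. An edgeless graph has to be excluded: its
  chromatic index is 1 and its maximum degree is 0.
\<close>

lemma balanced_chromatic_index_eq_iff:
  assumes G: "signed_graph G \<tau>" and bal: "balanced G \<tau>" and ne: "edges G \<noteq> {}"
  shows "chromatic_index G \<tau> = enat (max_degree G) \<longleftrightarrow>
    (\<exists>M. matching G M \<and> even (max_degree (delete_edges G M)))"
proof -
  have wf: "wf_multigraph G" using G by (simp add: signed_graph_def)
  have pos: "max_degree G > 0" using max_degree_pos[OF wf ne] .
  have "chromatic_index G \<tau> = enat (max_degree G) \<longleftrightarrow> chromatic_index G \<tau> \<le> enat (max_degree G)"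
    using max_degree_le_chromatic_index[OF wf] by (metis order.antisym order.refl)
  also have "\<dots> \<longleftrightarrow> (\<exists>M. matching G M \<and> even (max_degree (delete_edges G M)))"
  proof
    assume "chromatic_index G \<tau> \<le> enat (max_degree G)"
    then obtain i k c where c: "coloring G \<tau> i k c" and i: "i \<in> {0, 1}" "2 * k + i \<le> max_degree G"
      unfolding chromatic_index_le_iff by blast
    then have eq: "max_degree G = 2 * k + i" using max_degree_le_colors[OF wf c] by auto
    show "\<exists>M. matching G M \<and> even (max_degree (delete_edges G M))"
    proof (cases "i = 0")
      case True
      then show ?thesis using eq by (intro exI[of _ "{}"]) (simp add: matching_empty delete_edges_empty)
    next
      case False
      then have i1: "i = 1" using i by auto
      define M where "M = {e \<in> edges G. c e = Zero 0}"
      have M: "matching G M" "max_degree (delete_edges G M) \<le> 2 * k"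
        using coloring_zero_class[OF wf c[unfolded i1]] by (simp_all add: M_def)
      then have "max_degree (delete_edges G M) = 2 * k"
        using max_degree_delete_matching(1)[OF wf M(1)] eq i1 by simp
      then show ?thesis using M(1) by auto
    qed
  next
    assume "\<exists>M. matching G M \<and> even (max_degree (delete_edges G M))"
    then obtain M where M: "matching G M" "even (max_degree (delete_edges G M))" by blast
    note D = max_degree_delete_matching[OF wf M(1)]
    show "chromatic_index G \<tau> \<le> enat (max_degree G)"
    proof (cases "even (max_degree G)")
      case True
      then obtain k where k: "max_degree G = 2 * k" by blast
      then have "\<exists>c. coloring G \<tau> 0 k c"
        using balanced_coloring[OF G bal matching_empty, of k 0] pos by (simp add: delete_edges_empty)
      then show ?thesis using k by (auto simp: chromatic_index_le_iff)
    next
      case False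
      obtain k where k: "max_degree (delete_edges G M) = 2 * k" using M(2) by blast
      then have "max_degree G = 2 * k + 1" using D False by presburger
      moreover have "\<exists>c. coloring G \<tau> 1 k c"
        using balanced_coloring[OF G bal M(1), of k 1] k by simp
      ultimately show ?thesis by (auto simp: chromatic_index_le_iff)
    qed
  qed
  finally show ?thesis .
qed

section \<open>An extremal family\<close>

text \<open>
  The \<open>i\<close>-th edge consists of the half-edges \<open>2i\<close> and \<open>2i + 1\<close>. The edges 0 and 1 join the
  vertex 0 to the vertices 1 and 2. All others are loops, at 1 if \<open>i\<close> is even and at 2 if \<open>i\<close> is odd.
\<close>

definition two_bouquets :: "nat \<Rightarrow> (nat, nat) multigraph" where
  "two_bouquets m = \<lparr>verts = {0, 1, 2}, edges = (\<lambda>i. {2 * i, 2 * i + 1}) ` {..<2 * m + 2},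
     endpt = (\<lambda>h. if h = 0 \<or> h = 2 then 0 else if even (h div 2) then 1 else 2)\<rparr>"

lemma half_edges_two_bouquets: "half_edges (two_bouquets m) = {..<4 * m + 4}"
proof -
  have "h \<in> {2 * (h div 2), 2 * (h div 2) + 1}" for h :: nat by auto
  moreover have "h div 2 < 2 * m + 2" if "h < 4 * m + 4" for h using that by linarith
  ultimately show ?thesis by (fastforce simp: half_edges_def two_bouquets_def)
qed

lemma wf_two_bouquets: "wf_multigraph (two_bouquets m)"
proof -
  have "disjoint (edges (two_bouquets m))"
    unfolding disjoint_def two_bouquets_def by (auto; presburger)
  moreover have "endpt (two_bouquets m) h \<in> verts (two_bouquets m)" for h by (simp add: two_bouquets_def)
  ultimately show ?thesis by (auto simp: wf_multigraph_def) (auto simp: two_bouquets_def)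
qed

lemma degree_two_bouquets:
  "degree (two_bouquets m) 0 = 2" "degree (two_bouquets m) 1 = 2 * m + 1"
  "degree (two_bouquets m) 2 = 2 * m + 1"
proof -
  have 0: "half_edges_at (two_bouquets m) 0 = {0, 2}"
    unfolding half_edges_at_def half_edges_two_bouquets by (auto simp: two_bouquets_def)
  have 1: "half_edges_at (two_bouquets m) 1 = (\<lambda>i. 4 * i) ` {1..m} \<union> (\<lambda>i. 4 * i + 1) ` {..m}"
  proof -
    have "h \<in> (\<lambda>i. 4 * i) ` {1..m} \<union> (\<lambda>i. 4 * i + 1) ` {..m}"
      if "h < 4 * m + 4" "h \<noteq> 0" "even (h div 2)" for h
    proof -
      obtain j where "h div 2 = 2 * j" using \<open>even (h div 2)\<close> by (rule evenE)
      then have "h = 4 * j \<or> h = 4 * j + 1" by presburger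
      then have "h = 4 * j \<and> j \<in> {1..m} \<or> h = 4 * j + 1 \<and> j \<in> {..m}" using that(1,2) by auto
      then show ?thesis by blast
    qed
    then show ?thesis unfolding half_edges_at_def half_edges_two_bouquets
      by (auto simp: two_bouquets_def split: if_splits)
  qed
  have 2: "half_edges_at (two_bouquets m) 2 = (\<lambda>i. 4 * i + 2) ` {1..m} \<union> (\<lambda>i. 4 * i + 3) ` {..m}"
  proof -
    have "h \<in> (\<lambda>i. 4 * i + 2) ` {1..m} \<union> (\<lambda>i. 4 * i + 3) ` {..m}"
      if "h < 4 * m + 4" "h \<noteq> 2" "odd (h div 2)" for h
    proof -
      obtain j where "h div 2 = 2 * j + 1" using \<open>odd (h div 2)\<close> by (rule oddE)
      then have "h = 4 * j + 2 \<or> h = 4 * j + 3" by presburger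
      then have "h = 4 * j + 2 \<and> j \<in> {1..m} \<or> h = 4 * j + 3 \<and> j \<in> {..m}" using that(1,2) by auto
      then show ?thesis by blast
    qed
    moreover have "odd ((4 * i + 2) div 2)" "odd ((4 * i + 3) div 2)" for i :: nat by presburger+
    ultimately show ?thesis unfolding half_edges_at_def half_edges_two_bouquets
      by (auto simp: two_bouquets_def split: if_splits)
  qed
  show "degree (two_bouquets m) 0 = 2" by (simp add: degree_def 0)
  have "card ((\<lambda>i. 4 * i) ` {1..m} \<union> (\<lambda>i. 4 * i + 1) ` {..m}) = m + (m + 1)"
    by (subst card_Un_disjoint) (auto simp: card_image inj_on_def, presburger)
  then show "degree (two_bouquets m) 1 = 2 * m + 1" unfolding degree_def 1 by linarith
  have "card ((\<lambda>i. 4 * i + 2) ` {1..m} \<union> (\<lambda>i. 4 * i + 3) ` {..m}) = m + (m + 1)"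
    by (subst card_Un_disjoint) (auto simp: card_image inj_on_def, presburger)
  then show "degree (two_bouquets m) 2 = 2 * m + 1" unfolding degree_def 2 by linarith
qed

lemma max_degree_two_bouquets:
  assumes "m > 0"
  shows "max_degree (two_bouquets m) = 2 * m + 1"
proof -
  have "verts (two_bouquets m) = {0, 1, 2}" by (simp add: two_bouquets_def)
  then show ?thesis using assms degree_two_bouquets[of m] by (simp add: max_degree_def)
qed

text \<open>
  To lower the maximum degree, the matching would have to cover both end vertices. It can do so only by
  both path edges, as the half-edges of a loop lie at the same vertex; but these edges meet in
  the vertex 0.
\<close>

lemma max_degree_two_bouquets_delete_matching:
  assumes m: "m > 0" and M: "matching (two_bouquets m) M"
  shows "max_degree (delete_edges (two_bouquets m) M) = 2 * m + 1"
proof (rule ccontr)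
  let ?G = "two_bouquets m" and ?p = "endpt (two_bouquets m)"
  assume ne: "max_degree (delete_edges ?G M) \<noteq> 2 * m + 1"
  have le: "max_degree (delete_edges ?G M) \<le> 2 * m + 1"
    using max_degree_delete_matching(2)[OF wf_two_bouquets M] max_degree_two_bouquets[OF m] by simp
  have inj: "h = h'" if "e \<in> M" "e' \<in> M" "h \<in> e" "h' \<in> e'" "?p h = ?p h'" for e e' h h'
    using M that unfolding matching_def inj_on_def by blast
  have ME: "e \<in> edges ?G" if "e \<in> M" for e using M that by (auto simp: matching_def)
  have "\<exists>e\<in>M. \<exists>h\<in>e. ?p h = v" if v: "v \<in> {1, 2}" for v
  proof (rule ccontr)
    assume none: "\<not> ?thesis"
    have "half_edges_at (delete_edges ?G M) v = half_edges_at ?G v"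
      using none unfolding half_edges_at_delete by (auto simp: half_edges_at_def half_edges_def)
    then have "degree (delete_edges ?G M) v = 2 * m + 1"
      using v degree_two_bouquets[of m] by (auto simp: degree_def)
    moreover have "v \<in> verts (delete_edges ?G M)" using v by (auto simp: delete_edges_def two_bouquets_def)
    ultimately have "2 * m + 1 \<le> max_degree (delete_edges ?G M)"
      using max_degree_le_iff[OF wf_delete_edges[OF wf_two_bouquets], of m M] by (metis order.refl)
    then show False using le ne by simp
  qed
  moreover have "\<exists>h\<in>e. h \<in> {0, 2} \<and> h div 2 mod 2 = v - 1" if e: "e \<in> M" "h \<in> e" "?p h = v" "v \<in> {1, 2}" for e h v
  proof (rule ccontr)
    assume none: "\<not> ?thesis"
    obtain i where i: "e = {2 * i, 2 * i + 1}" using ME[OF e(1)] by (auto simp: two_bouquets_def)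
    have "?p (2 * i) \<noteq> ?p (2 * i + 1)" using inj[OF e(1) e(1), of "2 * i" "2 * i + 1"] i by auto
    then have "i = 0 \<or> i = 1" by (auto simp: two_bouquets_def split: if_splits)
    then show False using none i e(2-4) by (auto simp: two_bouquets_def)
  qed
  ultimately obtain e e' h h' where "e \<in> M" "h \<in> e" "h \<in> {0, 2}" "h div 2 mod 2 = 0"
    "e' \<in> M" "h' \<in> e'" "h' \<in> {0, 2}" "h' div 2 mod 2 = 1"
    by (metis One_nat_def diff_Suc_1 insertI1 insertI2 one_add_one plus_1_eq_Suc diff_self_eq_0)
  then show False using inj[of e e' h h'] by (auto simp: two_bouquets_def)
qed

text \<open>
  Giving the two half-edges of each edge opposite orientations makes all edges positive, so the
  graph is balanced.
\<close>

lemma chromatic_index_bound_sharp: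
  "\<exists>(G :: (nat, nat) multigraph) \<tau>. signed_graph G \<tau> \<and> balanced G \<tau> \<and>
      max_degree G \<ge> n \<and> chromatic_index G \<tau> = enat (max_degree G + 1)"
proof (intro exI conjI)
  let ?G = "two_bouquets (Suc n)" and ?\<tau> = "\<lambda>h. if even h then 1 else - 1 :: int"
  have wf: "wf_multigraph ?G" by (rule wf_two_bouquets)
  then show G: "signed_graph ?G ?\<tau>" by (simp add: signed_graph_def orientation_def)
  have "sign ?\<tau> e = 1" if "e \<in> edges ?G" for e using that by (auto simp: two_bouquets_def sign_def)
  then have "(\<Prod>e\<in>edges C. sign ?\<tau> e) = 1" if "subgraph C ?G" for C
    using that by (intro prod.neutral) (auto simp: subgraph_def)
  then show bal: "balanced ?G ?\<tau>" by (simp add: balanced_def)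
  show "n \<le> max_degree ?G" by (simp add: max_degree_two_bouquets)
  have "edges ?G \<noteq> {}" by (simp add: two_bouquets_def lessThan_empty_iff)
  moreover have "odd (max_degree (delete_edges ?G M))" if "matching ?G M" for M
    using max_degree_two_bouquets_delete_matching[OF _ that] by simp
  ultimately have "chromatic_index ?G ?\<tau> \<noteq> enat (max_degree ?G)"
    using balanced_chromatic_index_eq_iff[OF G bal] by blast
  then show "chromatic_index ?G ?\<tau> = enat (max_degree ?G + 1)"
    using balanced_chromatic_index_le[OF G bal] max_degree_le_chromatic_index[OF wf, of ?\<tau>]
    by (cases "chromatic_index ?G ?\<tau>") auto
qed

theorem theorem3p1:
  "(\<forall>(G :: ('v, 'h) multigraph) \<tau>. signed_graph G \<tau> \<and> balanced G \<tau> \<longrightarrow>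
      chromatic_index G \<tau> \<le> enat (max_degree G + 1) \<and>
      (edges G \<noteq> {} \<longrightarrow>
        (chromatic_index G \<tau> = enat (max_degree G) \<longleftrightarrow>
          (\<exists>M. matching G M \<and> even (max_degree (delete_edges G M)))))) \<and>
   (\<forall>n. \<exists>(G :: (nat, nat) multigraph) \<tau>. signed_graph G \<tau> \<and> balanced G \<tau> \<and>
      max_degree G \<ge> n \<and> chromatic_index G \<tau> = enat (max_degree G + 1))"
  using balanced_chromatic_index_le balanced_chromatic_index_eq_iff chromatic_index_bound_sharp by blast

end
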